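(* Let $n$ be a positive integer. For every quandle $X$ of cardinality $n$ there exists an injective quandle homomorphism $X\to Q\mathfrak{S}_n$.
   Context: A quandle is a non-empty set $X$ with a binary operation $\triangleleft$ such that: (Q1) $x\triangleleft x=x$ for all $x$; (Q2) for every $y\in X$ the map $x\mapsto x\triangleleft y$ is bijective; (Q3) $(x\triangleleft y)\triangleleft z=(x\triangleleft z)\triangleleft(y\triangleleft z)$ for all $x,y,z$. A quandle homomorphism is a map $f$ with $f(x\triangleleft x')=f(x)\triangleleft f(x')$. Let $[n]=\{1,\dots,n\}$ and let $\mathfrak{S}_n$ be the symmetric group on $[n]$, with permutations multiplied from left to right ($\sigma\tau:=\tau\circ\sigma$), so that $i^\sigma:=\sigma(i)$ is a right action of $\mathfrak{S}_n$ on $[n]$. $Q\mathfrak{S}_n$ is the quandle with underlying set $[n]\times\mathfrak{S}_n$ and operation $$(i,\sigma)\triangleleft(j,\tau):=(i^{\sigma^{-1}\tau},\,\tau^{-1}\sigma\tau).$$ *)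

theory Defs
  imports Main "HOL-Library.FuncSet" "HOL-Combinatorics.Permutations"
begin

locale quandle =
  fixes X :: "'a set" and op :: "'a \<Rightarrow> 'a \<Rightarrow> 'a" (infixl "\<lhd>" 70)
  assumes nonempty: "X \<noteq> {}"
    and closed: "\<lbrakk>x \<in> X; y \<in> X\<rbrakk> \<Longrightarrow> x \<lhd> y \<in> X"
    and Q1: "x \<in> X \<Longrightarrow> x \<lhd> x = x"
    and Q2: "y \<in> X \<Longrightarrow> bij_betw (\<lambda>x. x \<lhd> y) X X"
    and Q3: "\<lbrakk>x \<in> X; y \<in> X; z \<in> X\<rbrakk> \<Longrightarrow> (x \<lhd> y) \<lhd> z = (x \<lhd> z) \<lhd> (y \<lhd> z)"

definition quandle_hom ::
  "'a set \<Rightarrow> ('a \<Rightarrow> 'a \<Rightarrow> 'a) \<Rightarrow> 'b set \<Rightarrow> ('b \<Rightarrow> 'b \<Rightarrow> 'b) \<Rightarrow> ('a \<Rightarrow> 'b) set"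
  where "quandle_hom X op Y op' =
    {f \<in> X \<rightarrow> Y. \<forall>x\<in>X. \<forall>x'\<in>X. f (op x x') = op' (f x) (f x')}"

text \<open>Permutations are multiplied from left to right, so that \<open>i\<^sup>\<sigma> = \<sigma> i\<close> is a right action.\<close>

definition perm_mult :: "(nat \<Rightarrow> nat) \<Rightarrow> (nat \<Rightarrow> nat) \<Rightarrow> nat \<Rightarrow> nat" (infixl "\<star>" 75)
  where "\<sigma> \<star> \<tau> = \<tau> \<circ> \<sigma>"

text \<open>An element of the symmetric group on \<open>{1..n}\<close> is a function on \<open>nat\<close> that restricts to a
  bijection of \<open>{1..n}\<close> and is the identity elsewhere, so inverses may be taken on all of
  \<open>nat\<close>.\<close>

definition QS_carrier :: "nat \<Rightarrow> (nat \<times> (nat \<Rightarrow> nat)) set"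
  where "QS_carrier n = {1..n} \<times> {\<sigma>. \<sigma> permutes {1..n}}"

fun QS_op :: "nat \<times> (nat \<Rightarrow> nat) \<Rightarrow> nat \<times> (nat \<Rightarrow> nat) \<Rightarrow> nat \<times> (nat \<Rightarrow> nat)"
  where "QS_op (i, \<sigma>) (j, \<tau>) = ((inv \<sigma> \<star> \<tau>) i, inv \<tau> \<star> \<sigma> \<star> \<tau>)"

lemma QS_op_closed:
  assumes "p \<in> QS_carrier n" "q \<in> QS_carrier n"
  shows "QS_op p q \<in> QS_carrier n"
proof -
  obtain i s j t where p: "p = (i, s)" and q: "q = (j, t)" by (metis surj_pair)
  have s: "s permutes {1..n}" and t: "t permutes {1..n}" and i: "i \<in> {1..n}"
    using assms by (auto simp: p q QS_carrier_def)
  have "t (inv s i) \<in> {1..n}"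
    using s t i by (metis permutes_in_image permutes_inv)
  moreover have "t \<circ> (s \<circ> inv t) permutes {1..n}"
    using s t by (intro permutes_compose permutes_inv)
  ultimately show ?thesis by (simp add: p q QS_carrier_def perm_mult_def)
qed

lemma QS_quandle:
  assumes "n > 0"
  shows "quandle (QS_carrier n) QS_op"
proof
  show "QS_carrier n \<noteq> {}"
  proof -
    have "(1, id) \<in> {1..n} \<times> {\<sigma>. \<sigma> permutes {1..n}}"
      using assms by (intro SigmaI CollectI permutes_id) simp
    then show ?thesis unfolding QS_carrier_def by blast
  qed
next
  fix p q assume "p \<in> QS_carrier n" "q \<in> QS_carrier n"
  then show "QS_op p q \<in> QS_carrier n" by (rule QS_op_closed)
next
  fix p assume "p \<in> QS_carrier n"
  then show "QS_op p p = p"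
    by (cases p) (auto simp: QS_carrier_def perm_mult_def permutes_inverses permutes_inv_o
        fun_eq_iff)
next
  fix q assume qC: "q \<in> QS_carrier n"
  obtain j t where q: "q = (j, t)" by (metis surj_pair)
  have t: "t permutes {1..n}" using qC by (auto simp: q QS_carrier_def)
  define g where "g = (\<lambda>(k, r). (inv t (r k), inv t \<circ> r \<circ> t))"
  have g1: "g (QS_op p q) = p" if "p \<in> QS_carrier n" for p
    using that t by (cases p) (auto simp: g_def q QS_carrier_def perm_mult_def
        permutes_inverses fun_eq_iff)
  show "bij_betw (\<lambda>p. QS_op p q) (QS_carrier n) (QS_carrier n)"
  proof -
    have inj: "inj_on (\<lambda>p. QS_op p q) (QS_carrier n)"
      using g1 by (metis inj_onI)
    have fin: "finite (QS_carrier n)"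
      by (simp add: QS_carrier_def finite_permutations)
    have "(\<lambda>p. QS_op p q) ` QS_carrier n \<subseteq> QS_carrier n"
      using QS_op_closed qC by blast
    with inj fin show ?thesis
      by (simp add: bij_betw_def endo_inj_surj)
  qed
next
  fix p q r assume "p \<in> QS_carrier n" "q \<in> QS_carrier n" "r \<in> QS_carrier n"
  moreover obtain i s j t k u where e: "p = (i, s)" "q = (j, t)" "r = (k, u)"
    by (metis surj_pair)
  ultimately have s: "s permutes {1..n}" and t: "t permutes {1..n}" and u: "u permutes {1..n}"
    by (auto simp: QS_carrier_def)
  have inv_conj: "inv (u \<circ> (v \<circ> inv u)) = u \<circ> (inv v \<circ> inv u)" if "v permutes {1..n}" for v
    using that u
    by (intro inv_unique_comp) (auto simp: fun_eq_iff permutes_inverses)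
  show "QS_op (QS_op p q) r = QS_op (QS_op p r) (QS_op q r)"
  proof -
    have "inv (t \<circ> (s \<circ> inv t)) = t \<circ> (inv s \<circ> inv t)"
      using s t by (intro inv_unique_comp) (auto simp: fun_eq_iff permutes_inverses)
    then show ?thesis
      using s t u by (simp add: e perm_mult_def inv_conj fun_eq_iff permutes_inverses)
  qed
qed

end

theory Submission imports Defs begin

text \<open>
  In a quandle every right translation \<open>x \<mapsto> x \<lhd> y\<close> is a permutation, and Q3 says that it is an
  automorphism. An automorphism carries the translation by \<open>x\<close> to the translation by the image
  of \<open>x\<close>, so the translation by \<open>x \<lhd> y\<close> is the conjugate of the translation by \<open>x\<close> under the
  translation by \<open>y\<close>. Hence \<open>x \<mapsto>\<close> (translation by \<open>x\<close>) is a homomorphism to the conjugation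
  quandle of the symmetric group, but in general it is not injective: in a trivial quandle all
  translations are the identity. Recording \<open>x\<close> itself, as a label in \<open>{1..n}\<close>, in the first
  component restores injectivity.

  It remains to see that the first component is respected too. The operation of
  \<open>Q\<SS>\<^sub>n\<close> first applies \<open>\<sigma>\<^sup>-\<^sup>1\<close> to the label \<open>i\<close> and then \<open>\<tau>\<close>. By Q1 the
  translation by \<open>x\<close> fixes \<open>x\<close>, so on the pairs considered here \<open>\<sigma>\<^sup>-\<^sup>1\<close> has no effect on \<open>i\<close>,
  and \<open>\<tau>\<close> sends the label of \<open>x\<close> to the label of \<open>x \<lhd> y\<close>.
\<close>

context quandle
begin

text \<open>
  The right translation by \<open>y\<close>, transported along a labelling \<open>b\<close> of the elements of \<open>X\<close>; it is
  extended by the identity so that it permutes the set of labels in the sense of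
  \<^term>\<open>(permutes)\<close>.
\<close>

definition translation :: "('a \<Rightarrow> 'b) \<Rightarrow> 'a \<Rightarrow> 'b \<Rightarrow> 'b"
  where "translation b y k = (if k \<in> b ` X then b (inv_into X b k \<lhd> y) else k)"

lemma translation_label:
  assumes "inj_on b X" "x \<in> X"
  shows "translation b y (b x) = b (x \<lhd> y)"
  using assms by (simp add: translation_def)

lemma translation_permutes:
  assumes b: "inj_on b X" and y: "y \<in> X"
  shows "translation b y permutes b ` X"
proof (rule bij_imp_permutes)
  have label: "bij_betw b X (b ` X)"
    using b by (rule inj_on_imp_bij_betw)
  have "bij_betw (b \<circ> ((\<lambda>x. x \<lhd> y) \<circ> inv_into X b)) (b ` X) (b ` X)"
    by (rule bij_betw_trans[OF bij_betw_trans[OF bij_betw_inv_into[OF label] Q2[OF y]] label])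
  then show "bij_betw (translation b y) (b ` X) (b ` X)"
    by (subst bij_betw_cong) (simp_all add: translation_def)
qed (simp add: translation_def)

text \<open>
  Evaluated at the label of \<open>z\<close>, this is Q3 in the form
  \<open>(z \<lhd> y) \<lhd> (x \<lhd> y) = (z \<lhd> x) \<lhd> y\<close>.
\<close>

lemma translation_op_comp:
  assumes b: "inj_on b X" and x: "x \<in> X" and y: "y \<in> X"
  shows "translation b (x \<lhd> y) \<circ> translation b y = translation b y \<circ> translation b x"
proof
  fix k
  show "(translation b (x \<lhd> y) \<circ> translation b y) k = (translation b y \<circ> translation b x) k"
  proof (cases "k \<in> b ` X")
    case True
    then obtain z where z: "z \<in> X" "k = b z" by blast
    then show ?thesis
      using b x y Q3[OF z(1) x y] by (simp add: translation_label closed)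
  next
    case False
    then show ?thesis by (simp add: translation_def)
  qed
qed

lemma translation_op_conj:
  assumes "inj_on b X" "x \<in> X" "y \<in> X"
  shows "translation b (x \<lhd> y) = inv (translation b y) \<star> translation b x \<star> translation b y"
proof -
  have "translation b y \<circ> inv (translation b y) = id"
    using translation_permutes assms by (blast intro: permutes_inv_o)
  then have "translation b (x \<lhd> y)
      = translation b (x \<lhd> y) \<circ> translation b y \<circ> inv (translation b y)"
    by (simp add: comp_assoc)
  then show ?thesis
    using assms by (simp add: translation_op_comp perm_mult_def comp_assoc)
qed

lemma inv_translation_label_self:
  assumes "inj_on b X" "x \<in> X"
  shows "inv (translation b x) (b x) = b x"
  using permutes_inverses(2)[OF translation_permutes[OF assms], of "b x"] assms
  by (simp add: translation_label Q1)

lemma labelled_translation_hom: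
  assumes b: "bij_betw b X {1..n}"
  shows "(\<lambda>x. (b x, translation b x)) \<in> quandle_hom X (\<lhd>) (QS_carrier n) QS_op"
proof -
  have inj: "inj_on b X" and img: "b ` X = {1..n}"
    using b by (auto simp: bij_betw_def)
  have "(b x, translation b x) \<in> QS_carrier n" if "x \<in> X" for x
    using translation_permutes[OF inj that] that img by (auto simp: QS_carrier_def)
  moreover have "(b (x \<lhd> y), translation b (x \<lhd> y))
      = QS_op (b x, translation b x) (b y, translation b y)" if "x \<in> X" "y \<in> X" for x y
  proof -
    have "(inv (translation b x) \<star> translation b y) (b x) = b (x \<lhd> y)"
      using inj that by (simp add: perm_mult_def inv_translation_label_self translation_label)
    then show ?thesis
      using inj that by (simp add: translation_op_conj)
  qed
  ultimately show ?thesis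
    by (simp add: quandle_hom_def)
qed

end

theorem theorem1p4:
  fixes n :: nat and X :: "'a set" and op :: "'a \<Rightarrow> 'a \<Rightarrow> 'a"
  assumes "n > 0" and "quandle X op" and "card X = n"
  shows "\<exists>f \<in> quandle_hom X op (QS_carrier n) QS_op. inj_on f X"
proof -
  interpret quandle X op by fact
  have "finite X"
    using assms(1,3) by (intro card_ge_0_finite) simp
  then obtain b where b: "bij_betw b X {1..n}"
    using finite_same_card_bij[of X "{1..n}"] assms(3) by auto
  then have "inj_on (\<lambda>x. (b x, translation b x)) X"
    by (auto simp: bij_betw_def inj_on_def)
  with labelled_translation_hom[OF b] show ?thesis by blast
qed

end
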